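(* Let $\alpha$ be a real number and let $n\ge 1$ be an integer. Then $$n!\sum_{k=0}^{n-1}(-1)^{k}\frac{\binom{-\alpha}{k}}{n-k}=\sum_{k=0}^{n-1}(k+1)\,\mathbf{s}(n,k+1)\,\alpha^k.$$
   Context: For a real number $x$ and a nonnegative integer $k$, $\binom{x}{k}=\frac{x(x-1)\cdots(x-k+1)}{k!}$ is the generalized binomial coefficient, with $\binom{x}{0}=1$. $\mathbf{s}(n,k)$ denotes the unsigned Stirling numbers of the first kind: $x(x+1)\cdots(x+n-1)=\sum_{k=0}^n\mathbf{s}(n,k)x^k$. The convention $0^0=1$ is used when $\alpha=0$. *)

theory Defs
  imports Complex_Main "HOL-Combinatorics.Stirling"
begin

end

theory Submission
  imports Defs
begin

text \<open>
  Since \<open>(-1)\<^sup>k (-\<alpha> gchoose k) = pochhammer \<alpha> k / k!\<close>, both sides are the derivative at \<open>\<alpha>\<close> of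
  \<open>x(x+1)\<dots>(x+n-1)\<close>: both vanish for \<open>n = 0\<close> and both satisfy the recurrence
  \<open>R (n+1) = pochhammer \<alpha> n + (\<alpha> + n) R n\<close> that the product rule gives for this derivative.
\<close>

text \<open>Split the factor as \<open>n + 1 = (n + 1 - k) + k\<close>: the first part cancels the
  denominator, and the second, through \<open>(k + 1) * P (k + 1) = (a + k) * P k\<close> and an
  index shift, leads back to the denominators \<open>n - k\<close>.\<close>

lemma sum_pochhammer_divide_fact_diff_Suc:
  fixes a :: "'a :: field_char_0"
  defines "P \<equiv> \<lambda>k. pochhammer a k / fact k"
  shows "of_nat (Suc n) * (\<Sum>k<Suc n. P k / of_nat (Suc n - k))
       = P n + (a + of_nat n) * (\<Sum>k<n. P k / of_nat (n - k))"
proof -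
  have P_Suc: "of_nat (Suc k) * P (Suc k) = (a + of_nat k) * P k" for k
    by (simp add: P_def pochhammer_Suc divide_simps del: of_nat_Suc)
  have split_top: "of_nat m * x / of_nat (m - k) = x + of_nat k * x / of_nat (m - k)"
    if "k < m" for m k and x :: 'a
  proof -
    have "of_nat m = of_nat (m - k) + (of_nat k :: 'a)"
      using that by (simp flip: of_nat_add)
    moreover have "of_nat (m - k) \<noteq> (0 :: 'a)"
      using that by simp
    ultimately show ?thesis
      by (simp add: distrib_right add_divide_distrib del: of_nat_diff)
  qed
  have "of_nat (Suc n) * (\<Sum>k<Suc n. P k / of_nat (Suc n - k))
      = (\<Sum>k<Suc n. P k + of_nat k * P k / of_nat (Suc n - k))"
    unfolding sum_distrib_left times_divide_eq_right
    by (intro sum.cong refl split_top) simp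
  also have "\<dots> = (\<Sum>k<Suc n. P k) + (\<Sum>k<n. of_nat (Suc k) * P (Suc k) / of_nat (n - k))"
    unfolding sum.distrib
    by (subst (2) sum.lessThan_Suc_shift) simp
  \<comment> \<open>Here \<open>a + k = (a + n) - (n - k)\<close>; the resulting terms
    \<open>- P k\<close> later cancel all of the plain sum except \<open>P n\<close>.\<close>
  also have "(\<Sum>k<n. of_nat (Suc k) * P (Suc k) / of_nat (n - k))
      = (\<Sum>k<n. (a + of_nat n) * (P k / of_nat (n - k)) - P k)"
    unfolding P_Suc
    by (intro sum.cong refl) (simp add: distrib_right add_divide_distrib split_top del: of_nat_diff)
  also have "\<dots> = (a + of_nat n) * (\<Sum>k<n. P k / of_nat (n - k)) - (\<Sum>k<n. P k)"
    by (simp add: sum_subtractf sum_distrib_left)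
  finally show ?thesis by simp
qed

text \<open>Apply \<open>s(n+1,k+1) = n s(n,k+1) + s(n,k)\<close> and split the weight
  \<open>k + 1\<close> on the last term into \<open>k\<close> and \<open>1\<close>; the part with
  weight \<open>1\<close> is the expansion of \<open>pochhammer a n\<close>.\<close>

lemma sum_stirling_deriv_Suc:
  fixes a :: "'a :: comm_semiring_1"
  shows "(\<Sum>k<Suc n. of_nat (Suc k) * of_nat (stirling (Suc n) (Suc k)) * a ^ k)
       = pochhammer a n + (a + of_nat n) * (\<Sum>k<n. of_nat (Suc k) * of_nat (stirling n (Suc k)) * a ^ k)"
proof -
  have "(\<Sum>k<Suc n. of_nat (Suc k) * of_nat (stirling (Suc n) (Suc k)) * a ^ k)
      = of_nat n * (\<Sum>k<Suc n. of_nat (Suc k) * of_nat (stirling n (Suc k)) * a ^ k)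
        + (\<Sum>k<Suc n. of_nat k * of_nat (stirling n k) * a ^ k)
        + (\<Sum>k<Suc n. of_nat (stirling n k) * a ^ k)"
    unfolding sum_distrib_left sum.distrib[symmetric]
    by (intro sum.cong refl) (simp add: algebra_simps)
  also have "(\<Sum>k<Suc n. of_nat k * of_nat (stirling n k) * a ^ k)
      = a * (\<Sum>k<n. of_nat (Suc k) * of_nat (stirling n (Suc k)) * a ^ k)"
    unfolding sum.lessThan_Suc_shift sum_distrib_left
    by (simp add: algebra_simps)
  also have "(\<Sum>k<Suc n. of_nat (stirling n k) * a ^ k) = pochhammer a n"
    using stirling_pochhammer[of n a] by (simp add: lessThan_Suc_atMost)
  \<comment> \<open>The top term \<open>k = n\<close> of the first sum drops out since
    \<open>stirling n (Suc n) = 0\<close>.\<close>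
  finally show ?thesis
    by (simp add: algebra_simps)
qed

lemma fact_mult_sum_pochhammer_eq_sum_stirling:
  fixes a :: "'a :: field_char_0"
  shows "fact n * (\<Sum>k<n. pochhammer a k / fact k / of_nat (n - k))
       = (\<Sum>k<n. of_nat (Suc k) * of_nat (stirling n (Suc k)) * a ^ k)"
proof (induction n)
  case (Suc n)
  have "fact (Suc n) * (\<Sum>k<Suc n. pochhammer a k / fact k / of_nat (Suc n - k))
      = fact n * (of_nat (Suc n) * (\<Sum>k<Suc n. pochhammer a k / fact k / of_nat (Suc n - k)))"
    by (simp only: fact_Suc mult_ac)
  also have "\<dots> = pochhammer a n
      + (a + of_nat n) * (fact n * (\<Sum>k<n. pochhammer a k / fact k / of_nat (n - k)))"
    unfolding sum_pochhammer_divide_fact_diff_Suc by (simp add: algebra_simps)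
  finally show ?case
    unfolding Suc.IH sum_stirling_deriv_Suc .
qed simp

theorem theorem3:
  fixes \<alpha> :: real and n :: nat
  assumes "n \<ge> 1"
  shows "fact n * (\<Sum>k=0..n-1. (-1) ^ k * (((- \<alpha>) gchoose k) / real (n - k)))
       = (\<Sum>k=0..n-1. real (k + 1) * real (stirling n (k + 1)) * \<alpha> ^ k)"
proof -
  \<comment> \<open>Truncated subtraction would make the left side \<open>{0}\<close> at
    \<open>n = 0\<close>, hence the use of \<open>n \<ge> 1\<close>.\<close>
  have "{0..n-1} = {..<n}"
    using assms by auto
  moreover have "(-1) ^ k * ((- \<alpha>) gchoose k) = pochhammer \<alpha> k / fact k" for k
    by (simp add: gbinomial_pochhammer flip: power_mult_distrib)
  ultimately show ?thesis
    using fact_mult_sum_pochhammer_eq_sum_stirling[of n \<alpha>] by simp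
qed

end
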